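(* Let $\Omega$ be a completely regular Hausdorff topological space and let $C(\Omega)$ be the space of all real-valued continuous functions on $\Omega$, equipped with the compact-open topology. Let $Y$ be a sublattice of $C(\Omega)$ and let $\overline{Y}$ be its closure in $C(\Omega)$. Then each of the following sets equals $\overline{Y}$: $$Z_1=\{f\in C(\Omega) : \text{for every finite } F\subseteq\Omega \text{ there exists } g\in Y \text{ such that } f \text{ and } g \text{ agree on } F\},$$ $$Z_2=\{f\in C(\Omega) : \text{for all } s,t\in\Omega \text{ there exists } g\in Y \text{ with } f(s)=g(s) \text{ and } f(t)=g(t)\},$$ $$Z_3=\bigl(\{\delta_s-\gamma\delta_t : s,t\in\Omega,\ \gamma\ge 0\}\cap Y^\perp\bigr)_\perp,$$ $$Z_4=\bigl(\operatorname{span}\{\delta_s : s\in\Omega\}\cap Y^\perp\bigr)_\perp,$$ $$Z_5=\text{the intersection of all closed sublattices of } C(\Omega) \text{ of codimension at most } 1 \text{ that contain } Y.$$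
   Context: A sublattice of $C(\Omega)$ is a linear subspace closed under the pointwise operations $\vee$ and $\wedge$. "Closed" refers to the compact-open topology (uniform convergence on compact subsets of $\Omega$). For $t\in\Omega$, $\delta_t$ is the point evaluation functional $\delta_t(f)=f(t)$ on $C(\Omega)$. $Y^\perp$ denotes the set of all (continuous) linear functionals on $C(\Omega)$ vanishing on $Y$. For a set $B$ of linear functionals on $C(\Omega)$, $B_\perp=\{f\in C(\Omega) : \varphi(f)=0 \text{ for all } \varphi\in B\}$. A subspace $F$ of a vector space $E$ has codimension $n$ if $\dim E/F=n$. *)

theory Defs
  imports "HOL-Analysis.Analysis" "HOL-Library.Function_Algebras"
begin

text \<open>Pointwise vector space structure on functions, complementing \<open>Function_Algebras\<close>. The
  lattice operations \<open>sup\<close> and \<open>inf\<close> on functions are already pointwise.\<close>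

instantiation "fun" :: (type, scaleR) scaleR
begin

definition "a *\<^sub>R f = (\<lambda>x. a *\<^sub>R f x)"

instance ..

end

lemma scaleR_fun_apply [simp]: "(a *\<^sub>R f) x = a *\<^sub>R f x"
  by (simp add: scaleR_fun_def)

instance "fun" :: (type, real_vector) real_vector
  by standard (simp_all add: fun_eq_iff scaleR_add_right scaleR_add_left)


text \<open>\<open>C(X)\<close>. A function on the space is represented by a function on the ambient type that is
  \<open>0\<close> off the carrier; this makes \<open>C(X)\<close> closed under the pointwise operations.\<close>

definition cont_funs :: "'a topology \<Rightarrow> ('a \<Rightarrow> real) set" where
  "cont_funs X = {f. continuous_map X euclideanreal f \<and> (\<forall>x. x \<notin> topspace X \<longrightarrow> f x = 0)}"

definition compact_open_topology :: "'a topology \<Rightarrow> ('a \<Rightarrow> real) topology" where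
  "compact_open_topology X =
     topology_generated_by {{f \<in> cont_funs X. f ` K \<subseteq> U} | K U. compactin X K \<and> open U}"

definition sublattice :: "'a topology \<Rightarrow> ('a \<Rightarrow> real) set \<Rightarrow> bool" where
  "sublattice X Y \<longleftrightarrow> Y \<subseteq> cont_funs X \<and> subspace Y \<and>
     (\<forall>f\<in>Y. \<forall>g\<in>Y. sup f g \<in> Y \<and> inf f g \<in> Y)"

text \<open>Continuous linear functionals on \<open>C(X)\<close>, represented with value \<open>0\<close> off \<open>C(X)\<close>.\<close>

definition functionals :: "'a topology \<Rightarrow> (('a \<Rightarrow> real) \<Rightarrow> real) set" where
  "functionals X = {\<phi>.
     (\<forall>f\<in>cont_funs X. \<forall>g\<in>cont_funs X. \<phi> (f + g) = \<phi> f + \<phi> g) \<and>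
     (\<forall>a. \<forall>f\<in>cont_funs X. \<phi> (a *\<^sub>R f) = a * \<phi> f) \<and>
     continuous_map (compact_open_topology X) euclideanreal \<phi> \<and>
     (\<forall>f. f \<notin> cont_funs X \<longrightarrow> \<phi> f = 0)}"

definition point_eval :: "'a topology \<Rightarrow> 'a \<Rightarrow> ('a \<Rightarrow> real) \<Rightarrow> real" where
  "point_eval X t = (\<lambda>f. if f \<in> cont_funs X then f t else 0)"

definition annihilator :: "'a topology \<Rightarrow> ('a \<Rightarrow> real) set \<Rightarrow> (('a \<Rightarrow> real) \<Rightarrow> real) set" where
  "annihilator X Y = {\<phi> \<in> functionals X. \<forall>f\<in>Y. \<phi> f = 0}"

definition preannihilator :: "'a topology \<Rightarrow> (('a \<Rightarrow> real) \<Rightarrow> real) set \<Rightarrow> ('a \<Rightarrow> real) set" where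
  "preannihilator X B = {f \<in> cont_funs X. \<forall>\<phi>\<in>B. \<phi> f = 0}"

definition coset :: "'v::real_vector set \<Rightarrow> 'v \<Rightarrow> 'v set" where
  "coset F v = {v + w | w. w \<in> F}"

text \<open>\<open>dim E/F = n\<close>, for a linear subspace \<open>F\<close> of \<open>E\<close>: the quotient, whose elements are the cosets of
  elements of \<open>E\<close>, has a basis of \<open>n\<close> elements \<open>coset F (b i)\<close>. A linear combination of cosets is the
  coset of the linear combination of representatives.\<close>

definition has_codimension :: "'v::real_vector set \<Rightarrow> 'v set \<Rightarrow> nat \<Rightarrow> bool" where
  "has_codimension F E n \<longleftrightarrow> (\<exists>b. (\<forall>i<n. b i \<in> E) \<and>
     (\<forall>c. coset F (\<Sum>i<n. c i *\<^sub>R b i) = coset F 0 \<longrightarrow> (\<forall>i<n. c i = 0)) \<and>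
     (\<forall>Q \<in> coset F ` E. \<exists>c. Q = coset F (\<Sum>i<n. c i *\<^sub>R b i)))"


text \<open>The topology is that of uniform convergence on compact sets.\<close>

lemma openin_compact_open_topology_iff:
  "openin (compact_open_topology X) U \<longleftrightarrow> U \<subseteq> cont_funs X \<and>
     (\<forall>f\<in>U. \<exists>K e. compactin X K \<and> e > 0 \<and>
        {g \<in> cont_funs X. \<forall>x\<in>K. \<bar>g x - f x\<bar> < e} \<subseteq> U)" (is "_ \<longleftrightarrow> ?P U")
proof
  let ?S = "{{f \<in> cont_funs X. f ` K \<subseteq> U} | K U. compactin X K \<and> open (U::real set)}"
  assume "openin (compact_open_topology X) U"
  then have "generate_topology_on ?S U"
    by (simp add: compact_open_topology_def openin_topology_generated_by_iff)
  then show "?P U"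
  proof (induction rule: generate_topology_on.induct)
    case (Int A B)
    show ?case
    proof (intro conjI ballI)
      fix f assume f: "f \<in> A \<inter> B"
      obtain K e where 1: "compactin X K" "e > 0"
        "{g \<in> cont_funs X. \<forall>x\<in>K. \<bar>g x - f x\<bar> < e} \<subseteq> A" using Int f by blast
      obtain L d where 2: "compactin X L" "d > 0"
        "{g \<in> cont_funs X. \<forall>x\<in>L. \<bar>g x - f x\<bar> < d} \<subseteq> B" using Int f by blast
      have "{g \<in> cont_funs X. \<forall>x\<in>K \<union> L. \<bar>g x - f x\<bar> < min e d} \<subseteq> A \<inter> B"
        using 1(3) 2(3) by fastforce
      then show "\<exists>K e. compactin X K \<and> e > 0 \<and>
          {g \<in> cont_funs X. \<forall>x\<in>K. \<bar>g x - f x\<bar> < e} \<subseteq> A \<inter> B"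
        using 1 2 by (intro exI[of _ "K \<union> L"] exI[of _ "min e d"]) (simp add: compactin_Un)
    qed (use Int in blast)
  next
    case (UN \<K>)
    then show ?case by (meson Sup_least Union_iff Union_upper subset_trans)
  next
    case (Basis A)
    then obtain K V where A: "A = {f \<in> cont_funs X. f ` K \<subseteq> V}" "compactin X K" "open V"
      by blast
    show ?case
    proof (intro conjI ballI)
      fix f assume f: "f \<in> A"
      then have "compact (f ` K)"
        using A image_compactin[of X K euclideanreal f] by (auto simp: cont_funs_def)
      moreover have "f ` K \<subseteq> V" using A f by blast
      ultimately obtain e where e: "e > 0" "(\<Union>y\<in>f ` K. ball y e) \<subseteq> V"
        using compact_subset_open_imp_ball_epsilon_subset A(3) by metis
      have "{g \<in> cont_funs X. \<forall>x\<in>K. \<bar>g x - f x\<bar> < e} \<subseteq> A"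
      proof clarify
        fix g assume g: "g \<in> cont_funs X" "\<forall>x\<in>K. \<bar>g x - f x\<bar> < e"
        have "g x \<in> V" if "x \<in> K" for x
          using subsetD[OF e(2), of "g x"] g(2) that by (force simp: dist_real_def abs_minus_commute)
        then show "g \<in> A" using A g by auto
      qed
      then show "\<exists>K e. compactin X K \<and> e > 0 \<and>
          {g \<in> cont_funs X. \<forall>x\<in>K. \<bar>g x - f x\<bar> < e} \<subseteq> A"
        using A e by blast
    qed (use A in auto)
  qed auto
next
  assume P: "?P U"
  have "\<exists>W. openin (compact_open_topology X) W \<and> f \<in> W \<and> W \<subseteq> U" if f: "f \<in> U" for f
  proof -
    obtain K e where K: "compactin X K" "e > 0"
      "{g \<in> cont_funs X. \<forall>x\<in>K. \<bar>g x - f x\<bar> < e} \<subseteq> U" using P f by blast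
    have fc: "f \<in> cont_funs X" using P f by blast
    then have cm: "continuous_map X euclideanreal f" by (simp add: cont_funs_def)
    then have "compact (f ` K)"
      using K image_compactin[of X K euclideanreal f] by auto
    then obtain T where T: "finite T" "f ` K \<subseteq> (\<Union>t\<in>T. ball t (e/4))"
      using K(2) compact_eq_totally_bounded[of "f ` K"] by (metis divide_pos_pos zero_less_numeral)
    define L where "L t = {x \<in> topspace X. f x \<in> cball t (e/4)} \<inter> K" for t
    define B where "B t = {g \<in> cont_funs X. g ` L t \<subseteq> ball t (e/2)}" for t
    define C0 where "C0 = {g \<in> cont_funs X. g ` {} \<subseteq> (UNIV::real set)}"
    define W where "W = \<Inter> (insert C0 (B ` T))"
    have "compactin X (L t)" for t
      unfolding L_def
      by (intro closed_Int_compactin K closedin_continuous_map_preimage[OF cm]) auto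
    then have "openin (compact_open_topology X) (B t)" for t
      unfolding compact_open_topology_def B_def by (intro topology_generated_by_Basis) blast
    moreover have "openin (compact_open_topology X) C0"
      unfolding compact_open_topology_def C0_def by (intro topology_generated_by_Basis) blast
    ultimately have "openin (compact_open_topology X) W"
      unfolding W_def using T(1) by (intro openin_Inter) auto
    moreover have "f \<in> W"
      using fc K(2) by (force simp: W_def C0_def B_def L_def)
    moreover have "W \<subseteq> U"
    proof
      fix g assume g: "g \<in> W"
      have "\<bar>g x - f x\<bar> < e" if x: "x \<in> K" for x
      proof -
        obtain t where t: "t \<in> T" "f x \<in> ball t (e/4)" using T(2) x by blast
        then have "x \<in> L t" using x compactin_subset_topspace[OF K(1)] by (auto simp: L_def)
        moreover have "g \<in> B t" using g t(1) by (simp add: W_def)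
        ultimately have "g x \<in> ball t (e/2)" unfolding B_def by blast
        then show ?thesis using t(2) K(2) unfolding mem_ball dist_real_def by linarith
      qed
      then show "g \<in> U" using K(3) g by (auto simp: W_def C0_def)
    qed
    ultimately show ?thesis by blast
  qed
  then show "openin (compact_open_topology X) U"
    by (subst openin_subopen) blast
qed

end

theory Submission
  imports Defs
begin

text \<open>Write \<open>cl Y\<close> for the closure of \<open>Y\<close> and \<open>Z\<^sub>1, \<dots>, Z\<^sub>5\<close> for the five sets, in the order of the
  statement. They are compared by \<open>cl Y \<subseteq> Z\<^sub>4 \<subseteq> Z\<^sub>1 \<subseteq> Z\<^sub>2 \<subseteq> cl Y\<close>, \<open>Z\<^sub>4 \<subseteq> Z\<^sub>3 \<subseteq> Z\<^sub>2\<close> and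
  \<open>cl Y \<subseteq> Z\<^sub>5 \<subseteq> Z\<^sub>3\<close>.

  The lattice structure enters in two essential places. The inclusion \<open>Z\<^sub>2 \<subseteq> cl Y\<close> is the lattice form
  of the Stone-Weierstrass theorem (\<open>in_closure_if_two_point_agreement\<close>): let \<open>f\<close> be a function that
  can be interpolated in \<open>Y\<close> at any two points, and fix a compact set. For each of its points \<open>s\<close>, a
  finite supremum of interpolants agrees with \<open>f\<close> at \<open>s\<close> and exceeds \<open>f - e\<close> on the compact set; a
  finite infimum of such suprema lies between \<open>f - e\<close> and \<open>f + e\<close>.
  For \<open>Z\<^sub>3 \<subseteq> Z\<^sub>2\<close> (\<open>two_point_agreement\<close>), note that the restrictions of \<open>Y\<close> to two points form a
  sublattice of the plane, and that the only lines through the origin which are sublattices are the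
  axes and those of positive slope; each of them is the kernel of a functional \<open>\<delta>\<^sub>s - \<gamma> \<delta>\<^sub>t\<close> with
  \<open>\<gamma> \<ge> 0\<close>, up to exchanging the two points.

  The remaining inclusions are linear: \<open>Z\<^sub>4 \<subseteq> Z\<^sub>1\<close> is duality in finite dimension
  (\<open>finite_interpolation_alternative\<close>), \<open>cl Y \<subseteq> Z\<^sub>4\<close> holds since point evaluations are
  continuous, and \<open>Z\<^sub>5 \<subseteq> Z\<^sub>3\<close> since the kernel of \<open>\<delta>\<^sub>s - \<gamma> \<delta>\<^sub>t\<close> with \<open>\<gamma> \<ge> 0\<close> is a closed sublattice of
  codimension at most \<open>1\<close>.\<close>

section \<open>Interpolation on finite sets\<close>

lemma fun_sum_apply: "(\<Sum>i\<in>I. h i) x = (\<Sum>i\<in>I. h i x)"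
  by (induction I rule: infinite_finite_induct) auto

text \<open>Finite-dimensional duality: a function that agrees on \<open>F\<close> with no member of the subspace \<open>V\<close>
  is separated from \<open>V\<close> by a linear combination of evaluations at the points of \<open>F\<close>.\<close>

lemma finite_interpolation_alternative:
  fixes V :: "('a \<Rightarrow> real) set"
  assumes "finite F" "subspace V"
  shows "(\<exists>g\<in>V. \<forall>x\<in>F. f x = g x) \<or>
    (\<exists>c. (\<forall>g\<in>V. (\<Sum>x\<in>F. c x * g x) = 0) \<and> (\<Sum>x\<in>F. c x * f x) \<noteq> 0)"
  using assms
proof (induction F arbitrary: V f rule: finite_induct)
  case empty
  then show ?case using subspace_0 by blast
next
  case (insert a F)
  have upd: "(\<Sum>x\<in>insert a F. (c(a := d)) x * g x) = d * g a + (\<Sum>x\<in>F. c x * g x)"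
    for c d and g :: "'a \<Rightarrow> real"
    using insert.hyps by (auto intro!: sum.cong)
  show ?case
  proof (cases "\<forall>g\<in>V. g a = 0")
    case True
    show ?thesis
    proof (cases "f a = 0")
      case False
      then show ?thesis
        using True upd[of "\<lambda>x. 0" 1] by (intro disjI2 exI[of _ "(\<lambda>x. 0)(a := 1)"]) auto
    next
      case fa: True
      consider g where "g \<in> V" "\<forall>x\<in>F. f x = g x"
        | c where "\<forall>g\<in>V. (\<Sum>x\<in>F. c x * g x) = 0" "(\<Sum>x\<in>F. c x * f x) \<noteq> 0"
        using insert.IH[OF insert.prems, of f] by blast
      then show ?thesis
      proof cases
        case 1
        then show ?thesis using True fa by auto
      next
        case 2
        then show ?thesis
          using upd[of c 0] by (intro disjI2 exI[of _ "c(a := 0)"]) auto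
      qed
    qed
  next
    case False
    then obtain h0 where h0: "h0 \<in> V" "h0 a \<noteq> 0" by blast
    define h where "h = (1 / h0 a) *\<^sub>R h0"
    have h: "h \<in> V" "h a = 1"
      using h0 insert.prems by (auto simp: h_def subspace_scale)
    define W where "W = {g \<in> V. g a = 0}"
    have W: "subspace W"
      using insert.prems unfolding W_def subspace_def by auto
    have proj: "g - g a *\<^sub>R h \<in> W" if "g \<in> V" for g
      using that h insert.prems by (simp add: W_def subspace_diff subspace_scale)
    consider g where "g \<in> W" "\<forall>x\<in>F. (f - f a *\<^sub>R h) x = g x"
      | c where "\<forall>g\<in>W. (\<Sum>x\<in>F. c x * g x) = 0" "(\<Sum>x\<in>F. c x * (f - f a *\<^sub>R h) x) \<noteq> 0"
      using insert.IH[OF W, of "f - f a *\<^sub>R h"] by blast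
    then show ?thesis
    proof cases
      case 1
      have "g + f a *\<^sub>R h \<in> V"
        using 1(1) h(1) insert.prems by (simp add: W_def subspace_add subspace_scale)
      moreover have "\<forall>x\<in>insert a F. f x = (g + f a *\<^sub>R h) x"
        using 1 h(2) by (auto simp: W_def algebra_simps)
      ultimately show ?thesis by blast
    next
      case 2
      \<comment> \<open>The coefficient at \<open>a\<close> is chosen so that the combination kills \<open>h\<close>.\<close>
      define c' where "c' = c(a := - (\<Sum>x\<in>F. c x * h x))"
      have *: "(\<Sum>x\<in>insert a F. c' x * g x) = (\<Sum>x\<in>F. c x * (g - g a *\<^sub>R h) x)"
        for g :: "'a \<Rightarrow> real"
        unfolding c'_def upd
        by (simp add: right_diff_distrib sum_subtractf sum_distrib_left mult_ac)
      have "\<forall>g\<in>V. (\<Sum>x\<in>insert a F. c' x * g x) = 0"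
        using 2(1) proj unfolding * by blast
      moreover have "(\<Sum>x\<in>insert a F. c' x * f x) \<noteq> 0"
        using 2(2) unfolding * .
      ultimately show ?thesis by blast
    qed
  qed
qed

section \<open>Continuous functions and continuous functionals\<close>

lemma topspace_compact_open [simp]: "topspace (compact_open_topology X) = cont_funs X"
proof
  show "topspace (compact_open_topology X) \<subseteq> cont_funs X"
    using openin_topspace openin_compact_open_topology_iff by blast
  have "openin (compact_open_topology X) (cont_funs X)"
    unfolding openin_compact_open_topology_iff
    by (auto intro!: exI[of _ "{}"] exI[of _ 1])
  then show "cont_funs X \<subseteq> topspace (compact_open_topology X)"
    by (rule openin_subset)
qed

lemma subspace_cont_funs: "subspace (cont_funs X)"
  unfolding subspace_def cont_funs_def
  by (auto simp: plus_fun_def zero_fun_def scaleR_fun_def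
      intro!: continuous_map_add continuous_map_real_mult_left)

lemma cont_funs_sup_inf:
  assumes "f \<in> cont_funs X" "g \<in> cont_funs X"
  shows "sup f g \<in> cont_funs X" "inf f g \<in> cont_funs X"
  using assms unfolding cont_funs_def
  by (auto simp: sup_fun_def inf_fun_def sup_max inf_min
      intro!: continuous_map_real_max continuous_map_real_min)

lemma sublattice_cont_funs: "sublattice X (cont_funs X)"
  unfolding sublattice_def using subspace_cont_funs cont_funs_sup_inf by blast

lemma in_closure_of_compact_open:
  assumes "f \<in> cont_funs X"
    and "\<And>K e. compactin X K \<Longrightarrow> e > 0 \<Longrightarrow> \<exists>g\<in>Y. \<forall>x\<in>K. \<bar>g x - f x\<bar> < e"
    and "Y \<subseteq> cont_funs X"
  shows "f \<in> compact_open_topology X closure_of Y"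
  unfolding in_closure_of
proof (intro conjI allI impI)
  fix T assume "f \<in> T \<and> openin (compact_open_topology X) T"
  then obtain K e where "compactin X K" "e > 0"
    "{g \<in> cont_funs X. \<forall>x\<in>K. \<bar>g x - f x\<bar> < e} \<subseteq> T"
    unfolding openin_compact_open_topology_iff by blast
  then show "\<exists>y. y \<in> Y \<and> y \<in> T"
    using assms(2)[of K e] assms(3) by blast
qed (use assms in simp)

lemma subspace_functionals: "subspace (functionals X)"
  unfolding subspace_def functionals_def
  by (auto simp: plus_fun_def zero_fun_def scaleR_fun_def algebra_simps
      intro!: continuous_map_add continuous_map_real_mult_left)

lemma point_eval_functional:
  assumes "t \<in> topspace X"
  shows "point_eval X t \<in> functionals X"
proof -
  have "openin (compact_open_topology X) {f \<in> cont_funs X. f t \<in> U}" if U: "open U" for U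
    unfolding openin_compact_open_topology_iff
  proof (intro conjI ballI)
    fix f assume "f \<in> {f \<in> cont_funs X. f t \<in> U}"
    then obtain e where "e > 0" "ball (f t) e \<subseteq> U"
      using U open_contains_ball by blast
    then have "{g \<in> cont_funs X. \<forall>x\<in>{t}. \<bar>g x - f x\<bar> < e} \<subseteq> {f \<in> cont_funs X. f t \<in> U}"
      by (auto simp: subset_iff dist_real_def abs_minus_commute)
    then show "\<exists>K e. compactin X K \<and> 0 < e \<and>
        {g \<in> cont_funs X. \<forall>x\<in>K. \<bar>g x - f x\<bar> < e} \<subseteq> {f \<in> cont_funs X. f t \<in> U}"
      using \<open>e > 0\<close> assms by (intro exI[of _ "{t}"] exI[of _ e]) simp
  qed auto
  moreover have "{f \<in> cont_funs X. point_eval X t f \<in> U} = {f \<in> cont_funs X. f t \<in> U}" for U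
    by (auto simp: point_eval_def)
  ultimately have "continuous_map (compact_open_topology X) euclideanreal (point_eval X t)"
    by (simp add: continuous_map_def)
  then show ?thesis
    using subspace_cont_funs[of X]
    by (auto simp: functionals_def point_eval_def subspace_add subspace_scale)
qed

lemma span_point_eval_functionals: "span (point_eval X ` topspace X) \<subseteq> functionals X"
  using point_eval_functional by (intro span_minimal subspace_functionals) auto

lemma closedin_kernel:
  assumes "\<phi> \<in> functionals X"
  shows "closedin (compact_open_topology X) {f \<in> cont_funs X. \<phi> f = 0}"
  using closedin_continuous_map_preimage[of "compact_open_topology X" euclideanreal \<phi> "{0}"] assms
  by (simp add: functionals_def)

lemma closure_subset_preannihilator:
  assumes "Y \<subseteq> cont_funs X" "B \<subseteq> annihilator X Y"
  shows "compact_open_topology X closure_of Y \<subseteq> preannihilator X B"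
proof -
  have "compact_open_topology X closure_of Y \<subseteq> {f \<in> cont_funs X. \<phi> f = 0}" if "\<phi> \<in> B" for \<phi>
    using assms that by (intro closure_of_minimal closedin_kernel) (auto simp: annihilator_def)
  moreover have "compact_open_topology X closure_of Y \<subseteq> cont_funs X"
    using closure_of_subset_topspace[of "compact_open_topology X" Y] by simp
  ultimately show ?thesis
    unfolding preannihilator_def by blast
qed

lemma coset_eq_if_diff_mem:
  assumes L: "subspace L" and "v - w \<in> L"
  shows "coset L v = coset L w"
proof -
  have shift: "coset L a \<subseteq> coset L b" if "a - b \<in> L" for a b
  proof
    fix z assume "z \<in> coset L a"
    then obtain x where x: "z = a + x" "x \<in> L" by (auto simp: coset_def)
    then have "z = b + ((a - b) + x)" "(a - b) + x \<in> L"
      using subspace_add[OF L that] by auto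
    then show "z \<in> coset L b" unfolding coset_def by blast
  qed
  have "w - v \<in> L"
    using subspace_neg[OF L assms(2)] by simp
  then show ?thesis
    using shift assms(2) by (intro subset_antisym)
qed

lemma coset_eq_zero_imp_mem:
  assumes L: "subspace L" and "coset L v = coset L 0"
  shows "v \<in> L"
proof -
  have "v \<in> coset L v"
    using subspace_0[OF L] by (force simp: coset_def)
  then show ?thesis
    using assms(2) by (auto simp: coset_def)
qed

lemma has_codimension_oneI:
  assumes b: "b \<in> E" and "\<And>c. coset F (c *\<^sub>R b) = coset F 0 \<Longrightarrow> c = 0"
    and "\<And>v. v \<in> E \<Longrightarrow> \<exists>c. coset F v = coset F (c *\<^sub>R b)"
  shows "has_codimension F E 1"
  unfolding has_codimension_def
proof (intro exI[of _ "\<lambda>_. b"] conjI allI impI ballI)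
  fix c :: "nat \<Rightarrow> real" and i :: nat
  assume "coset F (\<Sum>i<1. c i *\<^sub>R b) = coset F 0" "i < 1"
  then show "c i = 0" using assms(2)[of "c 0"] by simp
next
  fix Q assume "Q \<in> coset F ` E"
  then obtain c where "Q = coset F (c *\<^sub>R b)" using assms(3) by blast
  then have "Q = coset F (\<Sum>i<1::nat. c *\<^sub>R b)" by simp
  then show "\<exists>c. Q = coset F (\<Sum>i<1::nat. c i *\<^sub>R b)" by (rule exI[of _ "\<lambda>_. c"])
qed (rule b)

lemma codimension_kernel_le_1:
  assumes \<phi>: "\<phi> \<in> functionals X"
  shows "\<exists>n\<le>1. has_codimension {f \<in> cont_funs X. \<phi> f = 0} (cont_funs X) n"
proof -
  let ?E = "cont_funs X"
  let ?L = "{f \<in> ?E. \<phi> f = 0}"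
  have add: "\<phi> (f + g) = \<phi> f + \<phi> g" if "f \<in> ?E" "g \<in> ?E" for f g
    using \<phi> that by (auto simp: functionals_def)
  have scale: "\<phi> (a *\<^sub>R f) = a * \<phi> f" if "f \<in> ?E" for a f
    using \<phi> that by (auto simp: functionals_def)
  note E = subspace_cont_funs[of X]
  have L: "subspace ?L"
  proof (rule subspaceI)
    show "0 \<in> ?L"
      using subspace_0[OF E] scale[OF subspace_0[OF E], of 0] by simp
  qed (use add scale subspace_add[OF E] subspace_scale[OF E] in auto)
  show ?thesis
  proof (cases "?L = ?E")
    case True
    have "coset ?L v = coset ?L 0" if "v \<in> ?E" for v
      using that True by (intro coset_eq_if_diff_mem L) auto
    then have "has_codimension ?L ?E 0"
      unfolding has_codimension_def by auto
    then show ?thesis by blast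
  next
    case False
    then obtain b where b: "b \<in> ?E" "\<phi> b \<noteq> 0" by blast
    have "c = 0" if "coset ?L (c *\<^sub>R b) = coset ?L 0" for c
      using coset_eq_zero_imp_mem[OF L that] scale[OF b(1)] b(2) by simp
    moreover have "coset ?L v = coset ?L ((\<phi> v / \<phi> b) *\<^sub>R b)" if v: "v \<in> ?E" for v
    proof (rule coset_eq_if_diff_mem[OF L])
      let ?w = "(- (\<phi> v / \<phi> b)) *\<^sub>R b"
      have w: "?w \<in> ?E" using b(1) by (rule subspace_scale[OF E])
      have "\<phi> (v + ?w) = 0"
        unfolding add[OF v w] scale[OF b(1)] using b(2) by simp
      then have "v + ?w \<in> ?L"
        using subspace_add[OF E v w] by blast
      then show "v - (\<phi> v / \<phi> b) *\<^sub>R b \<in> ?L"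
        by (simp only: scaleR_minus_left diff_conv_add_uminus)
    qed
    ultimately have "has_codimension ?L ?E 1"
      by (intro has_codimension_oneI[OF b(1)] exI) 
    then show ?thesis by blast
  qed
qed

lemma sublattice_two_point_kernel:
  assumes "\<gamma> \<ge> 0"
  shows "sublattice X {f \<in> cont_funs X. (point_eval X s - \<gamma> *\<^sub>R point_eval X t) f = 0}"
    (is "sublattice X ?L")
proof -
  have eq: "?L = {f \<in> cont_funs X. f s = \<gamma> * f t}"
    by (auto simp: point_eval_def)
  have "max (\<gamma> * a) (\<gamma> * b) = \<gamma> * max a b" "min (\<gamma> * a) (\<gamma> * b) = \<gamma> * min a b" for a b
    using assms by (simp_all add: max_mult_distrib_left min_mult_distrib_left)
  then have "sup f g \<in> ?L \<and> inf f g \<in> ?L" if "f \<in> ?L" "g \<in> ?L" for f g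
    using that cont_funs_sup_inf[of f X g] unfolding eq by (simp add: sup_max inf_min)
  moreover have "subspace ?L"
    unfolding eq using subspace_cont_funs[of X]
    by (auto intro!: subspaceI simp: subspace_0 subspace_add subspace_scale distrib_left)
  ultimately show ?thesis
    unfolding sublattice_def by blast
qed

section \<open>Approximation in sublattices\<close>

lemma compactin_directed_cover:
  assumes K: "compactin X K" and op: "\<And>U. U \<in> \<U> \<Longrightarrow> openin X U" and cov: "K \<subseteq> \<Union>\<U>"
    and ne: "\<U> \<noteq> {}" and dir: "\<And>U V. U \<in> \<U> \<Longrightarrow> V \<in> \<U> \<Longrightarrow> \<exists>W\<in>\<U>. U \<union> V \<subseteq> W"
  shows "\<exists>U\<in>\<U>. K \<subseteq> U"
proof -
  obtain \<F> where \<F>: "finite \<F>" "\<F> \<subseteq> \<U>" "K \<subseteq> \<Union>\<F>"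
    using compactinD[OF K op cov] by auto
  from \<F>(1,2) have "\<exists>W\<in>\<U>. \<Union>\<F> \<subseteq> W"
  proof (induction rule: finite_induct)
    case empty
    then show ?case using ne by blast
  next
    case (insert U \<F>)
    then obtain W where "W \<in> \<U>" "\<Union>\<F> \<subseteq> W" by auto
    moreover obtain Z where "Z \<in> \<U>" "U \<union> W \<subseteq> Z"
      using insert.prems dir[of U W] \<open>W \<in> \<U>\<close> by auto
    ultimately show ?case by (intro bexI[of _ Z]) auto
  qed
  then show ?thesis using \<F>(3) by (meson order_trans)
qed

text \<open>One half of the Stone-Weierstrass argument: pointwise lower bounds, up to \<open>e\<close>, in a family
  closed under suprema yield a uniform one.\<close>

lemma sup_closed_lower_bound_on_compact:
  assumes K: "compactin X K" and f: "f \<in> cont_funs X" and A: "A \<subseteq> cont_funs X" "A \<noteq> {}"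
    and sup: "\<And>g h. g \<in> A \<Longrightarrow> h \<in> A \<Longrightarrow> sup g h \<in> A"
    and pt: "\<And>t. t \<in> K \<Longrightarrow> \<exists>g\<in>A. f t - e < g t"
  shows "\<exists>g\<in>A. \<forall>x\<in>K. f x - e < g x"
proof -
  define U where "U g = {x \<in> topspace X. f x - g x \<in> {..<e}}" for g
  have "\<exists>V\<in>U ` A. K \<subseteq> V"
  proof (rule compactin_directed_cover[OF K])
    fix V assume "V \<in> U ` A"
    then obtain g where g: "V = U g" "g \<in> A" by blast
    then have "continuous_map X euclideanreal (\<lambda>x. f x - g x)"
      using f A by (auto simp: cont_funs_def intro!: continuous_map_diff)
    then show "openin X V"
      unfolding g U_def by (rule openin_continuous_map_preimage) simp
  next
    show "K \<subseteq> \<Union> (U ` A)"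
    proof
      fix t assume "t \<in> K"
      then obtain g where "g \<in> A" "f t - e < g t" "t \<in> topspace X"
        using pt compactin_subset_topspace[OF K] by blast
      then have "g \<in> A" "t \<in> U g" by (simp_all add: U_def)
      then show "t \<in> \<Union> (U ` A)" by blast
    qed
  next
    fix V W assume "V \<in> U ` A" "W \<in> U ` A"
    then obtain g h where gh: "V = U g" "W = U h" "g \<in> A" "h \<in> A" by blast
    have "U g \<subseteq> U (sup g h)" "U h \<subseteq> U (sup g h)"
      by (auto simp: U_def sup_max)
    then show "\<exists>Z\<in>U ` A. V \<union> W \<subseteq> Z"
      using sup[OF gh(3,4)] gh(1,2) by blast
  next
    show "U ` A \<noteq> {}" using A(2) by blast
  qed
  then obtain g where g: "g \<in> A" "K \<subseteq> U g" by blast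
  have "f x - e < g x" if "x \<in> K" for x
    using subsetD[OF g(2) that] by (simp add: U_def)
  then show ?thesis using g(1) by blast
qed

lemma inf_closed_upper_bound_on_compact:
  assumes K: "compactin X K" and f: "f \<in> cont_funs X" and A: "A \<subseteq> cont_funs X" "A \<noteq> {}"
    and inf: "\<And>g h. g \<in> A \<Longrightarrow> h \<in> A \<Longrightarrow> inf g h \<in> A"
    and pt: "\<And>t. t \<in> K \<Longrightarrow> \<exists>g\<in>A. g t < f t + e"
  shows "\<exists>g\<in>A. \<forall>x\<in>K. g x < f x + e"
proof -
  have neg: "- h \<in> cont_funs X" if "h \<in> cont_funs X" for h
    using that subspace_neg[OF subspace_cont_funs] by blast
  have "\<exists>g\<in>uminus ` A. \<forall>x\<in>K. (- f) x - e < g x"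
  proof (rule sup_closed_lower_bound_on_compact[OF K])
    fix g h assume "g \<in> uminus ` A" "h \<in> uminus ` A"
    then obtain g' h' where gh: "g = - g'" "h = - h'" "g' \<in> A" "h' \<in> A" by blast
    have "sup g h = - inf g' h'"
      unfolding gh by (auto simp: fun_eq_iff sup_max inf_min)
    then show "sup g h \<in> uminus ` A"
      using inf gh by blast
  next
    fix t assume "t \<in> K"
    then obtain g where g: "g \<in> A" "g t < f t + e" using pt by blast
    then show "\<exists>g\<in>uminus ` A. (- f) t - e < g t"
      by (intro bexI[of _ "- g"]) auto
  next
    show "- f \<in> cont_funs X" using f by (rule neg)
    show "uminus ` A \<subseteq> cont_funs X" using A(1) neg by blast
    show "uminus ` A \<noteq> {}" using A(2) by blast
  qed
  then obtain g where "g \<in> A" "\<forall>x\<in>K. (- f) x - e < (- g) x" by blast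
  then show ?thesis by (intro bexI[of _ g]) auto
qed

lemma in_closure_if_two_point_agreement:
  assumes Y: "sublattice X Y" and f: "f \<in> cont_funs X"
    and agree: "\<And>s t. s \<in> topspace X \<Longrightarrow> t \<in> topspace X \<Longrightarrow> \<exists>g\<in>Y. f s = g s \<and> f t = g t"
  shows "f \<in> compact_open_topology X closure_of Y"
proof (rule in_closure_of_compact_open[OF f])
  show Yc: "Y \<subseteq> cont_funs X" using Y by (simp add: sublattice_def)
  have lat: "sup g h \<in> Y" "inf g h \<in> Y" if "g \<in> Y" "h \<in> Y" for g h
    using Y that by (auto simp: sublattice_def)
  fix K and e :: real assume K: "compactin X K" and e: "e > 0"
  have Kt: "t \<in> topspace X" if "t \<in> K" for t
    using that compactin_subset_topspace[OF K] by blast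
  have above: "\<exists>h\<in>Y. h s = f s \<and> (\<forall>x\<in>K. f x - e < h x)" if s: "s \<in> K" for s
  proof -
    have "\<exists>h\<in>{h\<in>Y. h s = f s}. \<forall>x\<in>K. f x - e < h x"
    proof (rule sup_closed_lower_bound_on_compact[OF K f])
      show "{h \<in> Y. h s = f s} \<noteq> {}"
        using agree[OF Kt Kt, OF s s] by fastforce
      fix t assume t: "t \<in> K"
      obtain g where "g \<in> Y" "f s = g s" "f t = g t"
        using agree[OF Kt Kt, OF s t] by blast
      then show "\<exists>g\<in>{h \<in> Y. h s = f s}. f t - e < g t"
        using e by (intro bexI[of _ g]) auto
    qed (use Yc lat in auto)
    then show ?thesis by blast
  qed
  show "\<exists>g\<in>Y. \<forall>x\<in>K. \<bar>g x - f x\<bar> < e"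
  proof (cases "K = {}")
    case True
    then show ?thesis using Y subspace_0 by (auto simp: sublattice_def)
  next
    case False
    let ?A = "{h \<in> Y. \<forall>x\<in>K. f x - e < h x}"
    have "\<exists>g\<in>?A. \<forall>x\<in>K. g x < f x + e"
    proof (rule inf_closed_upper_bound_on_compact[OF K f])
      show "?A \<noteq> {}"
        using above False by blast
      fix t assume "t \<in> K"
      then obtain h where "h \<in> ?A" "h t = f t" using above by blast
      then show "\<exists>g\<in>?A. g t < f t + e"
        using e by (intro bexI[of _ h]) auto
    next
      fix g h assume "g \<in> ?A" "h \<in> ?A"
      then show "inf g h \<in> ?A" using lat by (simp add: inf_min)
    qed (use Yc in blast)
    then obtain g where "g \<in> ?A" "\<forall>x\<in>K. g x < f x + e" by blast
    then show ?thesis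
      by (intro bexI[of _ g] ballI) (auto simp: abs_less_iff algebra_simps)
  qed
qed

text \<open>On a sublattice, any linear relation between the values at two points reduces to relations of
  the form \<open>g s = \<gamma> g t\<close> with \<open>\<gamma> \<ge> 0\<close>: a relation with \<open>\<gamma> < 0\<close>, applied to \<open>\<bar>g\<bar>\<close>, forces both values to
  vanish.\<close>

lemma two_point_agreement:
  assumes Y: "sublattice X Y"
    and rel: "\<And>u v \<gamma>. u \<in> {s, t} \<Longrightarrow> v \<in> {s, t} \<Longrightarrow> \<gamma> \<ge> 0 \<Longrightarrow> \<forall>g\<in>Y. g u = \<gamma> * g v \<Longrightarrow> f u = \<gamma> * f v"
  shows "\<exists>g\<in>Y. f s = g s \<and> f t = g t"
proof (rule ccontr)
  assume no: "\<not> ?thesis"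
  have sub: "subspace Y" and sup: "\<And>g h. g \<in> Y \<Longrightarrow> h \<in> Y \<Longrightarrow> sup g h \<in> Y"
    using Y by (auto simp: sublattice_def)
  have vanish: "f u = 0" if "u \<in> {s, t}" "\<forall>g\<in>Y. g u = 0" for u
    using rel[of u u 0] that by simp
  obtain c where c: "\<forall>g\<in>Y. (\<Sum>x\<in>{s, t}. c x * g x) = 0" "(\<Sum>x\<in>{s, t}. c x * f x) \<noteq> 0"
    using finite_interpolation_alternative[OF _ sub, of "{s, t}" f] no by auto
  show False
  proof (cases "s = t")
    case True
    then show False using c vanish[of s] by simp
  next
    case False
    have c0: "c s * g s + c t * g t = 0" if "g \<in> Y" for g
      using c(1) that False by simp
    have cf: "c s * f s + c t * f t \<noteq> 0"
      using c(2) False by simp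
    show False
    proof (cases "c s = 0")
      case True
      then have "c t \<noteq> 0" using cf by auto
      then show False using True c0 cf vanish[of t] by simp
    next
      case cs: False
      define \<gamma> where "\<gamma> = - c t / c s"
      have g: "g s = \<gamma> * g t" if "g \<in> Y" for g
        using c0[OF that] cs by (simp add: \<gamma>_def field_simps)
      show False
      proof (cases "\<gamma> \<ge> 0")
        case True
        then have "f s = \<gamma> * f t" using rel[of s t \<gamma>] g by simp
        then show False using cf cs by (simp add: \<gamma>_def field_simps)
      next
        case neg: False
        have "g s = 0 \<and> g t = 0" if "g \<in> Y" for g
        proof -
          have "sup g (- g) \<in> Y" using that sup subspace_neg[OF sub] by blast
          moreover have "sup g (- g) x = \<bar>g x\<bar>" for x
            by (auto simp: sup_max)
          ultimately have "\<bar>g s\<bar> = \<gamma> * \<bar>g t\<bar>" using g[of "sup g (- g)"] by simp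
          moreover have "\<gamma> * \<bar>g t\<bar> \<le> 0" using neg by (simp add: mult_nonpos_nonneg)
          ultimately have "g s = 0" by linarith
          then show ?thesis using g[OF that] neg by auto
        qed
        then show False using cf vanish[of s] vanish[of t] by simp
      qed
    qed
  qed
qed

section \<open>The closure of a sublattice\<close>

theorem theorem2p1:
  fixes X :: "'a topology" and Y :: "('a \<Rightarrow> real) set"
  assumes "completely_regular_space X" and "Hausdorff_space X"
    and "sublattice X Y"
  shows "{f \<in> cont_funs X. \<forall>F. finite F \<and> F \<subseteq> topspace X \<longrightarrow> (\<exists>g\<in>Y. \<forall>x\<in>F. f x = g x)}
           = compact_open_topology X closure_of Y
       \<and> {f \<in> cont_funs X. \<forall>s\<in>topspace X. \<forall>t\<in>topspace X. \<exists>g\<in>Y. f s = g s \<and> f t = g t}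
           = compact_open_topology X closure_of Y
       \<and> preannihilator X
           ({point_eval X s - \<gamma> *\<^sub>R point_eval X t | s t \<gamma>.
               s \<in> topspace X \<and> t \<in> topspace X \<and> \<gamma> \<ge> 0} \<inter> annihilator X Y)
           = compact_open_topology X closure_of Y
       \<and> preannihilator X (span (point_eval X ` topspace X) \<inter> annihilator X Y)
           = compact_open_topology X closure_of Y
       \<and> \<Inter> {L. sublattice X L \<and> closedin (compact_open_topology X) L \<and>
               (\<exists>n\<le>1. has_codimension L (cont_funs X) n) \<and> Y \<subseteq> L}
           = compact_open_topology X closure_of Y"
proof -
  let ?cl = "compact_open_topology X closure_of Y"
  let ?Z1 = "{f \<in> cont_funs X. \<forall>F. finite F \<and> F \<subseteq> topspace X \<longrightarrow> (\<exists>g\<in>Y. \<forall>x\<in>F. f x = g x)}"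
  let ?Z2 = "{f \<in> cont_funs X. \<forall>s\<in>topspace X. \<forall>t\<in>topspace X. \<exists>g\<in>Y. f s = g s \<and> f t = g t}"
  let ?D = "{point_eval X s - \<gamma> *\<^sub>R point_eval X t | s t \<gamma>.
               s \<in> topspace X \<and> t \<in> topspace X \<and> \<gamma> \<ge> 0}"
  let ?S = "span (point_eval X ` topspace X)"
  let ?Z3 = "preannihilator X (?D \<inter> annihilator X Y)"
  let ?Z4 = "preannihilator X (?S \<inter> annihilator X Y)"
  let ?Z5 = "\<Inter> {L. sublattice X L \<and> closedin (compact_open_topology X) L \<and>
               (\<exists>n\<le>1. has_codimension L (cont_funs X) n) \<and> Y \<subseteq> L}"
  have Yc: "Y \<subseteq> cont_funs X" and sub: "subspace Y"
    using assms(3) by (auto simp: sublattice_def)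
  have D_S: "?D \<subseteq> ?S"
  proof clarify
    fix s t \<gamma> assume "s \<in> topspace X" "t \<in> topspace X"
    then have "point_eval X s \<in> ?S" "point_eval X t \<in> ?S"
      by (simp_all add: span_base)
    then show "point_eval X s - \<gamma> *\<^sub>R point_eval X t \<in> ?S"
      by (intro span_diff span_scale)
  qed
  have D_fun: "?D \<subseteq> functionals X"
    using D_S span_point_eval_functionals by blast
  have cl_Z4: "?cl \<subseteq> ?Z4"
    using Yc by (rule closure_subset_preannihilator) blast
  have Z4_Z1: "?Z4 \<subseteq> ?Z1"
  proof
    fix f assume f: "f \<in> ?Z4"
    then have fc: "f \<in> cont_funs X" by (simp add: preannihilator_def)
    have "\<exists>g\<in>Y. \<forall>x\<in>F. f x = g x" if F: "finite F" "F \<subseteq> topspace X" for F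
    proof (rule ccontr)
      assume "\<not> ?thesis"
      then obtain c where c: "\<forall>g\<in>Y. (\<Sum>x\<in>F. c x * g x) = 0" "(\<Sum>x\<in>F. c x * f x) \<noteq> 0"
        using finite_interpolation_alternative[OF F(1) sub, of f] by blast
      define \<phi> where "\<phi> = (\<Sum>x\<in>F. c x *\<^sub>R point_eval X x)"
      have \<phi>: "\<phi> g = (\<Sum>x\<in>F. c x * g x)" if "g \<in> cont_funs X" for g
        using that by (simp add: \<phi>_def fun_sum_apply point_eval_def)
      have S: "\<phi> \<in> ?S"
        unfolding \<phi>_def using F by (intro span_sum span_scale span_base) blast
      then have "\<phi> \<in> annihilator X Y"
        using span_point_eval_functionals \<phi> c(1) Yc by (auto simp: annihilator_def)
      then have "\<phi> f = 0" using f S by (simp add: preannihilator_def)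
      then show False using \<phi>[OF fc] c(2) by simp
    qed
    then show "f \<in> ?Z1" using fc by blast
  qed
  have Z1_Z2: "?Z1 \<subseteq> ?Z2"
  proof
    fix f assume f: "f \<in> ?Z1"
    then have Z1: "\<forall>F. finite F \<and> F \<subseteq> topspace X \<longrightarrow> (\<exists>g\<in>Y. \<forall>x\<in>F. f x = g x)"
      unfolding mem_Collect_eq by (rule conjunct2)
    have "\<exists>g\<in>Y. f s = g s \<and> f t = g t" if "s \<in> topspace X" "t \<in> topspace X" for s t
      using spec[OF Z1, of "{s, t}"] that by simp
    moreover have "f \<in> cont_funs X"
      using f unfolding mem_Collect_eq by (rule conjunct1)
    ultimately show "f \<in> ?Z2" by blast
  qed
  have Z2_cl: "?Z2 \<subseteq> ?cl"
    using in_closure_if_two_point_agreement[OF assms(3)] by blast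
  have Z4_Z3: "?Z4 \<subseteq> ?Z3"
    using D_S unfolding preannihilator_def by blast
  have Z3_Z2: "?Z3 \<subseteq> ?Z2"
  proof
    fix f assume f: "f \<in> ?Z3"
    then have fc: "f \<in> cont_funs X" by (simp add: preannihilator_def)
    have rel: "f u = \<gamma> * f v"
      if "u \<in> topspace X" "v \<in> topspace X" "\<gamma> \<ge> 0" "\<forall>g\<in>Y. g u = \<gamma> * g v" for u v \<gamma>
    proof -
      let ?\<phi> = "point_eval X u - \<gamma> *\<^sub>R point_eval X v"
      have D: "?\<phi> \<in> ?D" using that by blast
      moreover have "?\<phi> \<in> functionals X"
        using D D_fun by (rule rev_subsetD)
      ultimately have "?\<phi> \<in> ?D \<inter> annihilator X Y"
        using that(4) Yc by (auto simp: annihilator_def point_eval_def)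
      then have "?\<phi> f = 0"
        using f unfolding preannihilator_def by blast
      then show ?thesis using fc by (simp add: point_eval_def)
    qed
    have "\<exists>g\<in>Y. f s = g s \<and> f t = g t" if "s \<in> topspace X" "t \<in> topspace X" for s t
      using that by (intro two_point_agreement[OF assms(3)] rel) auto
    then show "f \<in> ?Z2" using fc by blast
  qed
  have cl_Z5: "?cl \<subseteq> ?Z5"
  proof (rule Inter_greatest, clarify)
    fix L f assume "closedin (compact_open_topology X) L" "Y \<subseteq> L" "f \<in> ?cl"
    then show "f \<in> L"
      using subsetD[OF closure_of_minimal] by metis
  qed
  have Z5_le: "?Z5 \<subseteq> {f \<in> cont_funs X. \<phi> f = 0}"
    if \<phi>: "\<phi> \<in> annihilator X Y" and L: "sublattice X {f \<in> cont_funs X. \<phi> f = 0}" for \<phi>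
  proof (rule Inter_lower, intro CollectI conjI)
    have fn: "\<phi> \<in> functionals X" using \<phi> by (simp add: annihilator_def)
    show "closedin (compact_open_topology X) {f \<in> cont_funs X. \<phi> f = 0}"
      using fn by (rule closedin_kernel)
    show "\<exists>n\<le>1. has_codimension {f \<in> cont_funs X. \<phi> f = 0} (cont_funs X) n"
      using fn by (rule codimension_kernel_le_1)
    show "Y \<subseteq> {f \<in> cont_funs X. \<phi> f = 0}"
      using \<phi> Yc by (auto simp: annihilator_def)
  qed (rule L)
  have Z5_Z3: "?Z5 \<subseteq> ?Z3"
  proof
    fix f assume f: "f \<in> ?Z5"
    have "\<phi> f = 0" if \<phi>: "\<phi> \<in> ?D \<inter> annihilator X Y" for \<phi>
    proof -
      obtain s t \<gamma> where "\<phi> = point_eval X s - \<gamma> *\<^sub>R point_eval X t" "\<gamma> \<ge> 0"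
        using IntD1[OF \<phi>] by blast
      then have "sublattice X {f \<in> cont_funs X. \<phi> f = 0}"
        using sublattice_two_point_kernel[of \<gamma> X s t] by simp
      with \<phi> have "?Z5 \<subseteq> {f \<in> cont_funs X. \<phi> f = 0}"
        by (intro Z5_le) simp_all
      then show ?thesis using f by (auto dest: subsetD)
    qed
    moreover have "f \<in> cont_funs X"
    proof -
      \<comment> \<open>\<open>C(X)\<close>, the kernel of the functional \<open>0\<close>, takes part in the intersection.\<close>
      have "0 \<in> annihilator X Y"
        using subspace_0[OF subspace_functionals] by (simp add: annihilator_def)
      moreover have "{f \<in> cont_funs X. (0 :: ('a \<Rightarrow> real) \<Rightarrow> real) f = 0} = cont_funs X"
        by simp
      ultimately have "?Z5 \<subseteq> cont_funs X"
        using Z5_le[of 0] sublattice_cont_funs[of X] by (simp only: simp_thms)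
      then show ?thesis using f by (rule subsetD)
    qed
    ultimately show "f \<in> ?Z3"
      unfolding preannihilator_def by (intro CollectI conjI ballI)
  qed
  show ?thesis
  proof (intro conjI subset_antisym)
    show "?Z1 \<subseteq> ?cl" using Z1_Z2 Z2_cl by (rule subset_trans)
    show "?cl \<subseteq> ?Z1" using cl_Z4 Z4_Z1 by (rule subset_trans)
    show "?cl \<subseteq> ?Z2" using \<open>?cl \<subseteq> ?Z1\<close> Z1_Z2 by (rule subset_trans)
    show Z3_cl: "?Z3 \<subseteq> ?cl" using Z3_Z2 Z2_cl by (rule subset_trans)
    show "?cl \<subseteq> ?Z3" using cl_Z4 Z4_Z3 by (rule subset_trans)
    show "?Z4 \<subseteq> ?cl" using Z4_Z3 Z3_cl by (rule subset_trans)
    show "?Z5 \<subseteq> ?cl" using Z5_Z3 Z3_cl by (rule subset_trans)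
  qed (fact Z2_cl cl_Z4 cl_Z5)+
qed

end
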